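(* Any Hausdorff $2$-path-flimsy topological space is homeomorphic to the standard circle $\mathbb{S}^1=\mathbb{R}/\mathbb{Z}$.
   Context: A topological space $X$ is $2$-path-flimsy if $|X|>2$ and if, for any subset $S\subseteq X$, the subspace $X\setminus S$ is path-connected whenever $|S|<2$ and is not path-connected whenever $|S|=2$. Path-connectedness is the usual one (paths parametrized by $[0,1]$), with the empty space considered path-connected. *)

theory Defs
  imports "HOL-Analysis.Analysis"
begin

(* card is 0 on infinite sets: hence the disjunction for |X| > 2, and the finiteness guard
   for |S| < 2 (card S = 2 already forces S to be finite). *)
definition two_path_flimsy :: "'a topology \<Rightarrow> bool" where
  "two_path_flimsy X \<longleftrightarrow>
     (infinite (topspace X) \<or> card (topspace X) > 2) \<and>
     (\<forall>S \<subseteq> topspace X.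
        (finite S \<and> card S < 2 \<longrightarrow> path_connected_space (subtopology X (topspace X - S))) \<and>
        (card S = 2 \<longrightarrow> \<not> path_connected_space (subtopology X (topspace X - S))))"

definition cong_Z :: "(real \<times> real) set" where
  "cong_Z = {(x, y). x - y \<in> \<int>}"

lemma equiv_cong_Z: "equiv UNIV cong_Z"
proof (rule equivI)
  show "sym cong_Z"
    by (auto simp: sym_def cong_Z_def) (metis Ints_minus minus_diff_eq)
  show "trans cong_Z"
    by (auto simp: trans_def cong_Z_def) (metis Ints_add diff_add_cancel add_diff_eq)
qed (auto simp: refl_on_def cong_Z_def)

(* The circle R/Z: its points are the cosets of Z in R, with the quotient topology of the
   usual topology on R (the preimage of U under the projection is the union of its cosets). *)
definition circle_R_mod_Z :: "real set topology" where
  "circle_R_mod_Z = topology (\<lambda>U. U \<subseteq> UNIV // cong_Z \<and> open (\<Union>U))"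

lemma openin_circle_R_mod_Z:
  "openin circle_R_mod_Z U \<longleftrightarrow> U \<subseteq> UNIV // cong_Z \<and> open (\<Union>U)"
proof -
  have "\<Union>(S \<inter> T) = \<Union>S \<inter> \<Union>T" if "S \<subseteq> UNIV // cong_Z" "T \<subseteq> UNIV // cong_Z" for S T
    using quotient_disj[OF equiv_cong_Z] that by blast
  moreover have "\<Union>(\<Union>K) = (\<Union>U\<in>K. \<Union>U)" for K :: "real set set set"
    by blast
  ultimately have "istopology (\<lambda>U. U \<subseteq> UNIV // cong_Z \<and> open (\<Union>U))"
    unfolding istopology_def by (auto simp: open_Int)
  then show ?thesis
    by (simp add: circle_R_mod_Z_def)
qed

lemma topspace_circle_R_mod_Z: "topspace circle_R_mod_Z = UNIV // cong_Z"
proof -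
  have "\<Union>(UNIV // cong_Z) = UNIV"
    by (rule Union_quotient[OF equiv_cong_Z])
  then have "openin circle_R_mod_Z (UNIV // cong_Z)"
    by (simp add: openin_circle_R_mod_Z)
  then show ?thesis
    by (metis openin_circle_R_mod_Z openin_subset openin_topspace subset_antisym)
qed

lemma quotient_map_circle_R_mod_Z:
  "quotient_map euclideanreal circle_R_mod_Z (\<lambda>x. cong_Z `` {x})"
proof -
  have "{x. cong_Z `` {x} \<in> U} = \<Union>U" if U: "U \<subseteq> UNIV // cong_Z" for U
  proof (intro set_eqI iffI)
    fix x assume "x \<in> {x. cong_Z `` {x} \<in> U}"
    then show "x \<in> \<Union>U"
      using equiv_class_self[OF equiv_cong_Z] by blast
  next
    fix x assume "x \<in> \<Union>U"
    then obtain A where A: "A \<in> U" "x \<in> A" by blast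
    then obtain y where "A = cong_Z `` {y}"
      using U by (blast elim: quotientE)
    with A have "A = cong_Z `` {x}"
      using equiv_class_eq[OF equiv_cong_Z, of y x] by simp
    with A show "x \<in> {x. cong_Z `` {x} \<in> U}" by simp
  qed
  then show ?thesis
    by (auto simp: quotient_map_def topspace_circle_R_mod_Z openin_circle_R_mod_Z quotient_def)
qed

end

theory Submission
  imports Defs "HOL-Probability.Discrete_Topology"
begin

text \<open>
  Let \<open>X\<close> be Hausdorff and 2-path-flimsy.  Call \<open>x\<close> and \<open>y\<close> separated by \<open>{a, b}\<close> if
  no path in \<open>X\<close> from \<open>x\<close> to \<open>y\<close> avoids both \<open>a\<close> and \<open>b\<close>.

  The first observation concerns a single pair \<open>{p, q}\<close>.  A point \<open>w\<close> of the complement can be joined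
  to \<open>p\<close> without meeting \<open>q\<close>, because removing one point leaves \<open>X\<close> path-connected; stopped when
  it first reaches \<open>p\<close>, such a path stays in the path component of \<open>w\<close> in \<open>X - {p, q}\<close>.
  The same works with \<open>p\<close> and \<open>q\<close> exchanged, so every path component of \<open>X - {p, q}\<close> contains the
  interior of a path from \<open>p\<close> to \<open>q\<close>.

  Two consequences follow.  First, separation is symmetric (\<open>separation_symmetric\<close>): if \<open>{p, q}\<close>
  separates \<open>a\<close> from \<open>b\<close>, then \<open>{a, b}\<close> separates \<open>p\<close> from \<open>q\<close>.  Otherwise \<open>X - {a, b}\<close> would have a
  path component containing neither \<open>p\<close> nor \<open>q\<close>, and a path from \<open>a\<close> to \<open>b\<close> through that component
  would avoid \<open>p\<close> and \<open>q\<close>.  Secondly, since paths in Hausdorff spaces contain arcs, two different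
  path components of \<open>X - {p, q}\<close> provide two arcs from \<open>p\<close> to \<open>q\<close>, which together form a simple
  closed curve \<open>C\<close> (\<open>exists_separated_arcs\<close>).

  Any two points \<open>c\<close>, \<open>d\<close> of \<open>C\<close> are separated by two further points of \<open>C\<close>
  (\<open>circle_points_separated\<close>).  This forces \<open>X = C\<close> (\<open>separated_arcs_cover\<close>).  A path from
  a point \<open>z\<close> outside \<open>C\<close> first meets \<open>C\<close> at some point \<open>c\<close>; another path from \<open>z\<close>, avoiding \<open>c\<close>, first
  meets \<open>C\<close> at some \<open>d \<noteq> c\<close>; together they join \<open>c\<close> to \<open>d\<close> without meeting \<open>C\<close> elsewhere, so no two
  further points of \<open>C\<close> separate \<open>c\<close> from \<open>d\<close>.  Finally, the closed path running around \<open>C\<close> and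
  the projection of the reals onto their classes modulo the integers present \<open>X\<close> and the circle as
  quotients of the same interval with the same fibres.

  The existence of arcs reduces to the corresponding theorem for paths in a Banach space:
  a Hausdorff space that is the image of a path embeds in a space of bounded functions
  (\<open>Hausdorff_path_image_embeds\<close>).
\<close>

section \<open>Paths in Hausdorff spaces contain arcs\<close>

lemma countable_finite_Unions_rational_intervals:
  "countable {\<Union>F |F. finite F \<and> F \<subseteq> (\<lambda>(a,b). {a..b::real}) ` (\<rat> \<times> \<rat>)}"
proof -
  have "countable ((\<lambda>(a,b). {a..b::real}) ` (\<rat> \<times> \<rat>))"
    by (intro countable_image countable_SIGMA) (auto simp: countable_rat)
  then have "countable {F. finite F \<and> F \<subseteq> (\<lambda>(a,b). {a..b::real}) ` (\<rat> \<times> \<rat>)}"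
    by (metis (mono_tags, lifting) Collect_cong countable_Collect_finite_subset)
  then have "countable (Union ` {F. finite F \<and> F \<subseteq> (\<lambda>(a,b). {a..b::real}) ` (\<rat> \<times> \<rat>)})"
    by (rule countable_image)
  then show ?thesis
    by (simp add: setcompr_eq_image)
qed

lemma compact_between_open_rational_intervals:
  fixes K U :: "real set"
  assumes "compact K" "open U" "K \<subseteq> U"
  obtains F where "finite F" "F \<subseteq> (\<lambda>(a,b). {a..b::real}) ` (\<rat> \<times> \<rat>)" "K \<subseteq> \<Union>F" "\<Union>F \<subseteq> U"
proof -
  have "\<exists>a b. a \<in> \<rat> \<and> b \<in> \<rat> \<and> x \<in> {a<..<b} \<and> {a..b} \<subseteq> U" if "x \<in> K" for x
  proof -
    obtain e where e: "e > 0" "cball x e \<subseteq> U"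
      using assms \<open>x \<in> K\<close> open_contains_cball by blast
    obtain a where a: "a \<in> \<rat>" "x - e < a" "a < x"
      using Rats_dense_in_real[of "x - e" x] e by auto
    obtain b where b: "b \<in> \<rat>" "x < b" "b < x + e"
      using Rats_dense_in_real[of x "x + e"] e by auto
    have "{a..b} \<subseteq> cball x e"
      using a b by (auto simp: dist_real_def)
    with a b e show ?thesis by force
  qed
  then obtain a b where ab: "\<And>x. x \<in> K \<Longrightarrow> a x \<in> \<rat> \<and> b x \<in> \<rat> \<and> x \<in> {a x<..<b x} \<and> {a x..b x} \<subseteq> U"
    by metis
  obtain T where T: "T \<subseteq> K" "finite T" "K \<subseteq> (\<Union>x\<in>T. {a x<..<b x})"
  proof (rule compactE_image[OF assms(1), of K "\<lambda>x. {a x<..<b x}"])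
    show "K \<subseteq> (\<Union>x\<in>K. {a x<..<b x})"
      using ab by blast
  qed auto
  show ?thesis
  proof
    show "finite ((\<lambda>x. {a x..b x}) ` T)" using T by simp
    show "(\<lambda>x. {a x..b x}) ` T \<subseteq> (\<lambda>(a,b). {a..b::real}) ` (\<rat> \<times> \<rat>)"
    proof (rule image_subsetI)
      fix x assume "x \<in> T"
      then have "(a x, b x) \<in> \<rat> \<times> \<rat>" using T ab by blast
      then show "{a x..b x} \<in> (\<lambda>(a,b). {a..b::real}) ` (\<rat> \<times> \<rat>)"
        by (rule rev_image_eqI) simp
    qed
    have "{a x<..<b x} \<subseteq> {a x..b x}" for x by auto
    then show "K \<subseteq> (\<Union>x\<in>T. {a x..b x})" using T(3) by blast
    show "(\<Union>x\<in>T. {a x..b x}) \<subseteq> U" using T ab by blast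
  qed
qed

text \<open>For every pair of finite unions \<open>A\<close>, \<open>B\<close> of rational intervals whose images under the path are
  disjoint, Urysohn's lemma gives a function separating these images.  There are countably many such
  pairs, and they suffice: the fibres over two distinct points are disjoint compact sets, which can be
  thickened to such \<open>A\<close> and \<open>B\<close> inside the preimages of disjoint neighbourhoods of the points.\<close>

lemma countable_separating_functions:
  assumes "pathin Y p" "p ` {0..1} = topspace Y" "Hausdorff_space Y"
  obtains g :: "nat \<Rightarrow> 'a \<Rightarrow> real"
  where "\<And>n. continuous_map Y (top_of_set {0..1}) (g n)"
    "\<And>x y. \<lbrakk>x \<in> topspace Y; y \<in> topspace Y; x \<noteq> y\<rbrakk> \<Longrightarrow> \<exists>n. g n x \<noteq> g n y"
proof -
  have cmp: "compact_space Y"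
    using assms compactin_path_image compact_space_def by metis
  then have nrm: "normal_space Y"
    using assms(3) compact_Hausdorff_or_regular_imp_normal_space by blast
  have cont: "continuous_map (top_of_set {0..1}) Y p"
    using assms(1) by (simp add: pathin_def)
  define \<A> where "\<A> = {\<Union>F |F. finite F \<and> F \<subseteq> (\<lambda>(a,b). {a..b::real}) ` (\<rat> \<times> \<rat>)}"
  define D where "D = {AB \<in> \<A> \<times> \<A>. disjnt (p ` ({0..1} \<inter> fst AB)) (p ` ({0..1} \<inter> snd AB))}"
  have "countable (\<A> \<times> \<A>)"
    unfolding \<A>_def by (intro countable_SIGMA countable_finite_Unions_rational_intervals)
  then have D: "countable D"
    by (rule countable_subset[rotated]) (auto simp: D_def)
  have empA: "{} \<in> \<A>"
    unfolding \<A>_def by (auto intro!: exI[of _ "{}"])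
  then have Dne: "D \<noteq> {}"
    by (auto simp: D_def intro!: exI[of _ "{}"])
  have clA: "closedin Y (p ` ({0..1} \<inter> A))" if "A \<in> \<A>" for A
  proof -
    have "closed A"
      using that by (auto simp: \<A>_def intro!: closed_Union)
    then have "compact ({0..1} \<inter> A)"
      by (intro compact_Int_closed) auto
    then have "compactin (top_of_set {0..1}) ({0..1} \<inter> A)"
      by (simp add: compactin_subtopology)
    then have "compactin Y (p ` ({0..1} \<inter> A))"
      using cont image_compactin by blast
    then show ?thesis
      using assms(3) compactin_imp_closedin by blast
  qed
  have "\<exists>f. continuous_map Y (top_of_set {0..1::real}) f \<and> f ` (p ` ({0..1} \<inter> fst AB)) \<subseteq> {0} \<and> f ` (p ` ({0..1} \<inter> snd AB)) \<subseteq> {1}"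
    if "AB \<in> D" for AB
  proof -
    have "closedin Y (p ` ({0..1} \<inter> fst AB))" "closedin Y (p ` ({0..1} \<inter> snd AB))"
      using that by (auto simp: D_def intro!: clA)
    moreover have "disjnt (p ` ({0..1} \<inter> fst AB)) (p ` ({0..1} \<inter> snd AB))"
      using that by (simp add: D_def)
    ultimately show ?thesis
      using nrm unfolding normal_space_iff_Urysohn by blast
  qed
  then obtain f where f: "\<And>AB. AB \<in> D \<Longrightarrow> continuous_map Y (top_of_set {0..1::real}) (f AB)"
    "\<And>AB. AB \<in> D \<Longrightarrow> f AB ` (p ` ({0..1} \<inter> fst AB)) \<subseteq> {0}"
    "\<And>AB. AB \<in> D \<Longrightarrow> f AB ` (p ` ({0..1} \<inter> snd AB)) \<subseteq> {1}"
    by metis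
  \<comment> \<open>Every fibre has such a finite union around it whose image stays in a given neighbourhood.\<close>
  have fib: "\<exists>A\<in>\<A>. {t \<in> {0..1}. p t = x} \<subseteq> A \<and> p ` ({0..1} \<inter> A) \<subseteq> U" if U: "openin Y U" "x \<in> U" for x U
  proof -
    have "openin (top_of_set {0..1}) {t \<in> topspace (top_of_set {0..1}). p t \<in> U}"
      using cont U(1) by (rule openin_continuous_map_preimage)
    then obtain U' where U': "open U'" "{t \<in> {0..1}. p t \<in> U} = {0..1} \<inter> U'"
      by (auto simp: openin_open)
    have "closedin Y {x}"
      using assms(3) U by (metis Hausdorff_imp_t1_space closedin_t1_singleton openin_subset subsetD)
    then have "closedin (top_of_set {0..1}) {t \<in> topspace (top_of_set {0..1}). p t \<in> {x}}"
      by (rule closedin_continuous_map_preimage[OF cont])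
    then have "compact {t \<in> {0..1}. p t = x}"
      by (simp add: closedin_compact[of "{0..1}"])
    moreover have "{t \<in> {0..1}. p t = x} \<subseteq> U'"
      using U U' by auto
    ultimately obtain F where "finite F" "F \<subseteq> (\<lambda>(a,b). {a..b::real}) ` (\<rat> \<times> \<rat>)" 
      "{t \<in> {0..1}. p t = x} \<subseteq> \<Union>F" "\<Union>F \<subseteq> U'"
      by (rule compact_between_open_rational_intervals[OF _ U'(1)])
    moreover have "p ` ({0..1} \<inter> \<Union>F) \<subseteq> U" using \<open>\<Union>F \<subseteq> U'\<close> U'(2) by blast
    ultimately show ?thesis unfolding \<A>_def by blast
  qed
  show ?thesis
  proof
    show "continuous_map Y (top_of_set {0..1}) (f (from_nat_into D n))" for n
      using f(1) Dne from_nat_into by metis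
    fix x y assume xy: "x \<in> topspace Y" "y \<in> topspace Y" "x \<noteq> y"
    then obtain U V where UV: "openin Y U" "openin Y V" "x \<in> U" "y \<in> V" "disjnt U V"
      using assms(3) unfolding Hausdorff_space_def by metis
    obtain A where A: "A \<in> \<A>" "{t \<in> {0..1}. p t = x} \<subseteq> A" "p ` ({0..1} \<inter> A) \<subseteq> U"
      using fib UV by meson
    obtain B where B: "B \<in> \<A>" "{t \<in> {0..1}. p t = y} \<subseteq> B" "p ` ({0..1} \<inter> B) \<subseteq> V"
      using fib UV by meson
    have "disjnt (p ` ({0..1} \<inter> A)) (p ` ({0..1} \<inter> B))"
      using A B UV by (meson disjnt_subset1 disjnt_subset2)
    then have AB: "(A,B) \<in> D" using A B by (simp add: D_def)
    obtain s t where st: "s \<in> {0..1}" "p s = x" "t \<in> {0..1}" "p t = y"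
      using xy assms(2) by (metis imageE)
    then have "x \<in> p ` ({0..1} \<inter> A)" "y \<in> p ` ({0..1} \<inter> B)"
      using A(2) B(2) by blast+
    then have "f (A,B) x = 0" "f (A,B) y = 1"
      using f(2,3)[OF AB] by auto
    then show "\<exists>n. f (from_nat_into D n) x \<noteq> f (from_nat_into D n) y"
      using from_nat_into_to_nat_on[OF D AB] by (metis zero_neq_one)
  qed
qed

text \<open>The embedding sends a point to the sequence of the values of the separating functions, weighted by
  powers of \<open>1/2\<close> so that finitely many functions control the supremum distance.
  Sequences are indexed by the discrete copy of the naturals, whose metric makes the bounded
  continuous functions on it a complete normed space.\<close>

lemma Hausdorff_path_image_embeds:
  assumes "pathin Y p" "p ` {0..1} = topspace Y" "Hausdorff_space Y"
  obtains E :: "'a \<Rightarrow> (nat discrete \<Rightarrow>\<^sub>C real)"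
  where "embedding_map Y euclidean E"
proof -
  have cmp: "compact_space Y"
    using assms compactin_path_image compact_space_def by metis
  have cont: "continuous_map (top_of_set {0..1}) Y p"
    using assms(1) by (simp add: pathin_def)
  then have qm: "quotient_map (top_of_set {0..1}) Y p"
    using assms by (intro continuous_imp_quotient_map) (auto simp: compact_space_subtopology)
  obtain g :: "nat \<Rightarrow> 'a \<Rightarrow> real"
    where g: "\<And>n. continuous_map Y (top_of_set {0..1}) (g n)"
    and sep: "\<And>x y. \<lbrakk>x \<in> topspace Y; y \<in> topspace Y; x \<noteq> y\<rbrakk> \<Longrightarrow> \<exists>n. g n x \<noteq> g n y"
    using countable_separating_functions[OF assms] by blast
  have gb: "g n y \<in> {0..1}" if "y \<in> topspace Y" for n y
    using g[of n] that by (auto simp: continuous_map_in_subtopology)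
  define E :: "'a \<Rightarrow> (nat discrete \<Rightarrow>\<^sub>C real)" where "E y = Bcontfun (\<lambda>i. g (of_discrete i) y * (1/2) ^ of_discrete i)" for y
  have E: "apply_bcontfun (E y) (discrete n) = g n y * (1/2)^n" if "y \<in> topspace Y" for y n
  proof -
    have "(\<lambda>i. g (of_discrete i) y * (1/2) ^ of_discrete i) \<in> bcontfun"
    proof (rule bcontfun_normI)
      show "continuous_on UNIV (\<lambda>i. g (of_discrete i) y * (1/2) ^ of_discrete i)"
        by (simp add: continuous_on_open_vimage open_discrete)
      show "norm (g (of_discrete i) y * (1/2) ^ of_discrete i) \<le> 1" for i
        using gb[OF that, of "of_discrete i"] by (simp add: abs_mult mult_le_one power_le_one)
    qed
    then show ?thesis by (simp add: E_def Bcontfun_inverse discrete_inverse)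
  qed
  have "continuous_on {0..1} (E \<circ> p)"
    unfolding continuous_on_iff
  proof (intro ballI allI impI)
    fix s :: real and e :: real assume s: "s \<in> {0..1}" and "0 < e"
    \<comment> \<open>Coordinates from \<open>N\<close> on contribute less than \<open>e/2\<close>, as the functions take values in \<open>{0..1}\<close>.\<close>
    obtain N where N: "(1/2)^N < e/2"
      using real_arch_pow_inv[of "e/2" "1/2"] \<open>0 < e\<close> by auto
    have "continuous_on {0..1} (\<lambda>t. g n (p t))" for n
      using continuous_map_compose[OF cont g[of n]] by (simp add: continuous_map_in_subtopology o_def)
    then have "\<forall>\<^sub>F t in at s within {0..1}. dist (g n (p t)) (g n (p s)) < e/2" for n
      using s \<open>0 < e\<close> unfolding continuous_on_def by (intro tendstoD) auto
    then have "\<forall>\<^sub>F t in at s within {0..1}. \<forall>n\<in>{..<N}. dist (g n (p t)) (g n (p s)) < e/2"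
      by (intro eventually_ball_finite) auto
    then obtain d where d: "d > 0"
      "\<And>t n. \<lbrakk>t \<in> {0..1}; t \<noteq> s; dist t s < d; n < N\<rbrakk> \<Longrightarrow> dist (g n (p t)) (g n (p s)) < e/2"
      unfolding eventually_at by (metis lessThan_iff)
    have "dist ((E \<circ> p) t) ((E \<circ> p) s) < e" if t: "t \<in> {0..1}" "dist t s < d" for t
    proof -
      have pY: "p t \<in> topspace Y" "p s \<in> topspace Y"
        using s t assms(2) by auto
      have "dist (E (p t) (discrete n)) (E (p s) (discrete n)) \<le> e/2" for n
      proof -
        have eq: "dist (E (p t) (discrete n)) (E (p s) (discrete n))
              = dist (g n (p t)) (g n (p s)) * (1/2)^n"
          using pY by (simp add: E dist_real_def abs_mult flip: left_diff_distrib)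
        show ?thesis
        proof (cases "n < N")
          case True
          have "dist (g n (p t)) (g n (p s)) \<le> e/2"
            using d(2)[of t n] True t \<open>0 < e\<close> by (cases "t = s") (auto intro: less_imp_le)
          moreover have "(1/2::real)^n \<le> 1" by (simp add: power_le_one)
          ultimately have "dist (g n (p t)) (g n (p s)) * (1/2)^n \<le> (e/2) * 1"
            using \<open>0 < e\<close> by (intro mult_mono) auto
          then show ?thesis using eq by simp
        next
          case False
          have "dist (g n (p t)) (g n (p s)) \<le> 1"
            using gb[OF pY(1), of n] gb[OF pY(2), of n] by (auto simp: dist_real_def)
          moreover have "(1/2::real)^n \<le> (1/2)^N"
            using False by (intro power_decreasing) auto
          ultimately have "dist (g n (p t)) (g n (p s)) * (1/2)^n \<le> 1 * (1/2)^N"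
            by (intro mult_mono) auto
          then show ?thesis using eq N by linarith
        qed
      qed
      then have "dist (E (p t)) (E (p s)) \<le> e/2"
        by (metis dist_bound of_discrete_inverse)
      then show ?thesis using \<open>0 < e\<close> by simp
    qed
    then show "\<exists>d>0. \<forall>t\<in>{0..1}. dist t s < d \<longrightarrow> dist ((E \<circ> p) t) ((E \<circ> p) s) < e"
      using d(1) by blast
  qed
  then have cE: "continuous_map Y euclidean E"
    using continuous_compose_quotient_map_eq[OF qm, of euclidean E] by simp
  have "inj_on E (topspace Y)"
  proof (rule inj_onI, rule ccontr)
    fix x y assume xy: "x \<in> topspace Y" "y \<in> topspace Y" "E x = E y" "x \<noteq> y"
    then obtain n where "g n x \<noteq> g n y" using sep by blast
    then show False using xy E[of x n] E[of y n] by simp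
  qed
  then have "embedding_map Y euclidean E"
    using cE cmp by (intro continuous_imp_embedding_map) auto
  then show ?thesis using that by blast
qed

lemma Hausdorff_path_contains_arc:
  assumes "Hausdorff_space X" "pathin X p" "p 0 \<noteq> p 1"
  obtains q where "pathin X q" "inj_on q {0..1}" "q 0 = p 0" "q 1 = p 1" "q ` {0..1} \<subseteq> p ` {0..1}"
proof -
  let ?P = "p ` {0..1}" and ?Y = "subtopology X (p ` {0..1})"
  have sub: "?P \<subseteq> topspace X"
    using path_image_subset_topspace[OF assms(2)] by auto
  then have tY: "topspace ?Y = ?P"
    by (simp add: Int_absorb1)
  have pY: "pathin ?Y p"
    using assms(2) by (simp add: pathin_subtopology)
  have HY: "Hausdorff_space ?Y"
    using assms(1) by (rule Hausdorff_space_subtopology)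
  obtain E :: "'a \<Rightarrow> (nat discrete \<Rightarrow>\<^sub>C real)" where E: "embedding_map ?Y euclidean E"
    by (rule Hausdorff_path_image_embeds[OF pY _ HY]) (use tY in auto)
  then have hE: "homeomorphic_map ?Y (top_of_set (E ` ?P)) E"
    unfolding embedding_map_def tY .
  then obtain D where D: "homeomorphic_maps ?Y (top_of_set (E ` ?P)) E D"
    using homeomorphic_map_maps by blast
  have cD: "continuous_map (top_of_set (E ` ?P)) ?Y D" and DE: "\<And>x. x \<in> ?P \<Longrightarrow> D (E x) = x"
    and cE: "continuous_map ?Y (top_of_set (E ` ?P)) E"
    and ED: "\<And>y. y \<in> E ` ?P \<Longrightarrow> E (D y) = y"
    using D tY by (auto simp: homeomorphic_maps_def)
  have "pathin (top_of_set (E ` ?P)) (E \<circ> p)"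
    by (rule pathin_compose[OF pY cE])
  then have pE: "path (E \<circ> p)"
    by (simp add: pathin_canon_iff)
  have "pathstart (E \<circ> p) = E (p 0)" "pathfinish (E \<circ> p) = E (p 1)" "E (p 0) \<noteq> E (p 1)"
    using DE[of "p 0"] DE[of "p 1"] assms(3) by (auto simp: pathstart_def pathfinish_def)
  then obtain r where r: "arc r" "path_image r \<subseteq> path_image (E \<circ> p)"
    "pathstart r = E (p 0)" "pathfinish r = E (p 1)"
    by (rule path_contains_arc[OF pE])
  have rP: "r t \<in> E ` ?P" if "t \<in> {0..1}" for t
    using that r(2) unfolding path_image_def image_comp by blast
  have "pathin (top_of_set (E ` ?P)) r"
    using r(1) rP by (auto simp: pathin_canon_iff arc_def)
  then have q: "pathin ?Y (D \<circ> r)"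
    by (rule pathin_compose[OF _ cD])
  show ?thesis
  proof
    show "pathin X (D \<circ> r)" "(D \<circ> r) ` {0..1} \<subseteq> p ` {0..1}"
      using q by (auto simp: pathin_subtopology)
    show "inj_on (D \<circ> r) {0..1}"
    proof (rule inj_onI)
      fix s t assume st: "s \<in> {0..1}" "t \<in> {0..1}" "(D \<circ> r) s = (D \<circ> r) t"
      then have "r s = r t" using ED[OF rP] by (metis comp_apply)
      then show "s = t" using r(1) st by (auto simp: arc_def inj_on_def)
    qed
    show "(D \<circ> r) 0 = p 0" "(D \<circ> r) 1 = p 1"
      using r DE by (auto simp: pathstart_def pathfinish_def)
  qed
qed

lemma pathin_subpath:
  assumes "pathin X g" "u \<in> {0..1}" "v \<in> {0..1}"
  shows "pathin X (\<lambda>t. g (u + (v - u) * t))"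
proof -
  have "u + (v - u) * t \<in> {0..1}" if "t \<in> {0..1}" for t
  proof -
    have "u + (v - u) * t = (1 - t) * u + t * v" by (simp add: algebra_simps)
    moreover have "(1 - t) * u + t * v \<le> (1 - t) * 1 + t * 1"
      using that assms by (intro add_mono mult_left_mono) auto
    ultimately show ?thesis using that assms by auto
  qed
  then have "pathin (top_of_set {0..1}) (\<lambda>t. u + (v - u) * t)"
    by (auto simp: pathin_canon_iff path_def intro!: continuous_intros)
  then show ?thesis
    using assms(1) pathin_compose[of "top_of_set {0..1}" "\<lambda>t. u + (v - u) * t" X g]
    by (simp add: pathin_def o_def)
qed

text \<open>A path that ends in a closed set can be stopped at its first point in that set.\<close>

lemma path_first_hit:
  assumes "pathin X g" "closedin X C" "g 0 \<notin> C" "g 1 \<in> C"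
  obtains h where "pathin X h" "h 0 = g 0" "h 1 \<in> C" "\<And>t. \<lbrakk>0 \<le> t; t < 1\<rbrakk> \<Longrightarrow> h t \<notin> C"
    "h ` {0..1} \<subseteq> g ` {0..1}"
proof -
  let ?T = "{t \<in> {0..1}. g t \<in> C}"
  have "closedin (top_of_set {0..1}) {t \<in> topspace (top_of_set {0..1}). g t \<in> C}"
    using assms(1,2) unfolding pathin_def by (rule closedin_continuous_map_preimage)
  then have "compact ?T"
    by (simp add: closedin_compact[of "{0..1}"])
  moreover have "?T \<noteq> {}" using assms(4) by auto
  ultimately have "\<exists>u\<in>?T. \<forall>t\<in>?T. u \<le> t"
    by (rule compact_attains_inf)
  then obtain u where u: "u \<in> ?T" "\<forall>t\<in>?T. u \<le> t"
    by (rule bexE)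
  have "u > 0" using u(1) assms(3) by (cases "u = 0") auto
  show ?thesis
  proof
    show "pathin X (\<lambda>t. g (0 + (u - 0) * t))"
      using u(1) by (intro pathin_subpath[OF assms(1)]) auto
    have in01: "0 + (u - 0) * t \<in> {0..1}" if "t \<in> {0..1}" for t
      using u(1) that by (auto simp: mult_le_one)
    show "g (0 + (u - 0) * t) \<notin> C" if "0 \<le> t" "t < 1" for t
    proof
      assume "g (0 + (u - 0) * t) \<in> C"
      then have "u \<le> 0 + (u - 0) * t" using in01[of t] that u(2) by auto
      then show False using \<open>u > 0\<close> that by simp
    qed
    show "(\<lambda>t. g (0 + (u - 0) * t)) ` {0..1} \<subseteq> g ` {0..1}"
      using in01 by blast
  qed (use u in auto)
qed

section \<open>Separation by two points and pairs of separated arcs\<close>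

text \<open>\<open>joined_off X F x y\<close>: the points \<open>x\<close> and \<open>y\<close> are joined by a path in \<open>X\<close> that avoids \<open>F\<close>.  Thus
  \<open>{a, b}\<close> separates \<open>x\<close> from \<open>y\<close> if \<open>joined_off X {a, b} x y\<close> fails.\<close>

abbreviation joined_off :: "'a topology \<Rightarrow> 'a set \<Rightarrow> 'a \<Rightarrow> 'a \<Rightarrow> bool" where
  "joined_off X F \<equiv> path_component_of (subtopology X (topspace X - F))"

lemma joined_off_along_path:
  assumes "pathin X g" "0 \<le> u" "u \<le> v" "v \<le> 1" "\<And>t. \<lbrakk>u \<le> t; t \<le> v\<rbrakk> \<Longrightarrow> g t \<notin> F"
  shows "joined_off X F (g u) (g v)"
proof -
  have "pathin X (\<lambda>t. g (u + (v - u) * t))"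
    using assms by (intro pathin_subpath) auto
  moreover have "g (u + (v - u) * t) \<in> topspace X - F" if "t \<in> {0..1}" for t
  proof -
    have "(v - u) * t \<le> (v - u) * 1"
      using that assms by (intro mult_left_mono) auto
    moreover have "0 \<le> (v - u) * t"
      using that assms by simp
    ultimately have *: "u \<le> u + (v - u) * t" "u + (v - u) * t \<le> v" by auto
    then show ?thesis
      using assms path_image_subset_topspace[OF assms(1)] by fastforce
  qed
  ultimately have "pathin (subtopology X (topspace X - F)) (\<lambda>t. g (u + (v - u) * t))"
    by (simp add: pathin_subtopology)
  then show ?thesis
    unfolding path_component_of_def
    by (intro exI[of _ "\<lambda>t. g (u + (v - u) * t)"]) auto
qed

lemma joined_offE:
  assumes "joined_off X F x y"
  obtains g where "pathin X g" "g 0 = x" "g 1 = y" "\<And>t. \<lbrakk>0 \<le> t; t \<le> 1\<rbrakk> \<Longrightarrow> g t \<notin> F"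
  using assms unfolding path_component_of_def by (auto simp: pathin_subtopology)

text \<open>A pair of arcs, given by injective parametrizations on \<open>{0..1}\<close>, with the same initial point and the
  same final point, whose interiors are separated from each other by these two end points.  Their union
  is a simple closed curve.\<close>

definition separated_arcs :: "'a topology \<Rightarrow> (real \<Rightarrow> 'a) \<Rightarrow> (real \<Rightarrow> 'a) \<Rightarrow> bool" where
  "separated_arcs X \<alpha> \<beta> \<longleftrightarrow>
     pathin X \<alpha> \<and> inj_on \<alpha> {0..1} \<and> pathin X \<beta> \<and> inj_on \<beta> {0..1} \<and> \<alpha> 0 = \<beta> 0 \<and> \<alpha> 1 = \<beta> 1 \<and>
     (\<forall>s t. 0 < s \<and> s < 1 \<and> 0 < t \<and> t < 1 \<longrightarrow> \<not> joined_off X {\<alpha> 0, \<alpha> 1} (\<alpha> s) (\<beta> t))"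

lemma separated_arcs_sym: "separated_arcs X \<alpha> \<beta> \<Longrightarrow> separated_arcs X \<beta> \<alpha>"
  unfolding separated_arcs_def by (metis path_component_of_sym)

lemma arc_eqD: "\<lbrakk>inj_on \<alpha> {0..1::real}; \<alpha> s = \<alpha> t; 0 \<le> s; s \<le> 1; 0 \<le> t; t \<le> 1\<rbrakk> \<Longrightarrow> s = t"
  by (auto dest: inj_onD)

text \<open>The arcs of such a pair meet only in their common end points: a common interior point would be
  trivially joined to itself off the end points.\<close>

lemma separated_arcs_meet:
  assumes "separated_arcs X \<alpha> \<beta>" "0 \<le> s" "s \<le> 1" "0 \<le> t" "t \<le> 1" "\<alpha> s = \<beta> t"
  shows "s = t \<and> (s = 0 \<or> s = 1)"
proof -
  have A: "inj_on \<alpha> {0..1}" "inj_on \<beta> {0..1}" "\<alpha> 0 = \<beta> 0" "\<alpha> 1 = \<beta> 1" "pathin X \<alpha>"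
    and B: "\<And>s t. \<lbrakk>0 < s; s < 1; 0 < t; t < 1\<rbrakk> \<Longrightarrow> \<not> joined_off X {\<alpha> 0, \<alpha> 1} (\<alpha> s) (\<beta> t)"
    using assms(1) unfolding separated_arcs_def by auto
  show ?thesis
  proof (cases "s \<in> {0,1} \<or> t \<in> {0,1}")
    case True
    then show ?thesis
      using arc_eqD[OF A(1), of s t] arc_eqD[OF A(2), of s t] assms A(3,4) by auto
  next
    case False
    then have st: "0 < s" "s < 1" "0 < t" "t < 1"
      using assms by auto
    have "\<alpha> s \<noteq> \<alpha> 0" "\<alpha> s \<noteq> \<alpha> 1"
      using arc_eqD[OF A(1), of s 0] arc_eqD[OF A(1), of s 1] st by auto
    moreover have "\<alpha> s \<in> topspace X"
      using path_image_subset_topspace[OF A(5)] st by auto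
    ultimately have "joined_off X {\<alpha> 0, \<alpha> 1} (\<alpha> s) (\<beta> t)"
      using assms(6) by (auto simp: path_component_of_refl)
    then show ?thesis using B[OF st] by blast
  qed
qed

section \<open>The simple closed curve in a 2-path-flimsy space\<close>

locale Hausdorff_two_path_flimsy =
  fixes X :: "'a topology"
  assumes Hausdorff: "Hausdorff_space X"
    and flimsy: "two_path_flimsy X"
begin

lemma path_connected_minus_point:
  assumes "x \<in> topspace X"
  shows "path_connected_space (subtopology X (topspace X - {x}))"
proof -
  have "{x} \<subseteq> topspace X" "finite {x} \<and> card {x} < 2"
    using assms by auto
  then show ?thesis
    using flimsy unfolding two_path_flimsy_def by blast
qed

lemma not_path_connected_minus_two_points:
  assumes "x \<in> topspace X" "y \<in> topspace X" "x \<noteq> y"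
  shows "\<not> path_connected_space (subtopology X (topspace X - {x, y}))"
proof -
  have "{x, y} \<subseteq> topspace X" "card {x, y} = 2"
    using assms by auto
  then show ?thesis
    using flimsy unfolding two_path_flimsy_def by blast
qed

lemma two_points:
  obtains p q where "p \<in> topspace X" "q \<in> topspace X" "p \<noteq> q"
proof -
  have "infinite (topspace X) \<or> card (topspace X) > 2"
    using flimsy unfolding two_path_flimsy_def by blast
  then obtain T where "T \<subseteq> topspace X" "card T = 2"
    by (metis infinite_arbitrarily_large less_imp_le_nat obtain_subset_with_card_n)
  then show ?thesis
    using that by (auto simp: card_2_iff)
qed

text \<open>Each of two removed points can be reached from the path component of any other point: the path runs
  inside that component of \<open>X - {a, b}\<close> until it arrives at \<open>a\<close>.\<close>

lemma path_to_one_puncture: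
  assumes "a \<in> topspace X" "b \<in> topspace X" "a \<noteq> b" "w \<in> topspace X - {a, b}"
  obtains h where "pathin X h" "h 0 = w" "h 1 = a"
    "\<And>t. \<lbrakk>0 \<le> t; t < 1\<rbrakk> \<Longrightarrow> joined_off X {a, b} w (h t)"
proof -
  have "joined_off X {b} w a"
    using assms by (intro path_connected_space_imp_path_component_of path_connected_minus_point) auto
  then obtain g where g: "pathin X g" "g 0 = w" "g 1 = a" "\<And>t. \<lbrakk>0 \<le> t; t \<le> 1\<rbrakk> \<Longrightarrow> g t \<notin> {b}"
    by (rule joined_offE) blast
  have "closedin X {a}"
    using assms(1) Hausdorff by (simp add: Hausdorff_imp_t1_space closedin_t1_singleton)
  then obtain h where h: "pathin X h" "h 0 = w" "h 1 \<in> {a}" "\<And>t. \<lbrakk>0 \<le> t; t < 1\<rbrakk> \<Longrightarrow> h t \<notin> {a}"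
    "h ` {0..1} \<subseteq> g ` {0..1}"
    using path_first_hit[OF g(1), of "{a}"] g assms(4) by auto
  have hb: "h t \<noteq> b" if "0 \<le> t" "t \<le> 1" for t
    using h(5) g(4) that by fastforce
  have "joined_off X {a, b} w (h t)" if "0 \<le> t" "t < 1" for t
    using joined_off_along_path[OF h(1), of 0 t "{a,b}"] h hb that by auto
  then show ?thesis
    using that h by auto
qed

lemma separation_symmetric:
  assumes abpq: "a \<in> topspace X" "b \<in> topspace X" "a \<noteq> b" "{a, b} \<inter> {p, q} = {}"
    and nsep: "\<not> joined_off X {p, q} a b"
  shows "\<not> joined_off X {a, b} p q"
proof
  assume pq: "joined_off X {a, b} p q"
  \<comment> \<open>Some path component of \<open>X - {a, b}\<close> contains neither \<open>p\<close> nor \<open>q\<close>; passing through it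
    leads from \<open>a\<close> to \<open>b\<close> off \<open>{p, q}\<close>.\<close>
  have "\<exists>w \<in> topspace X - {a, b}. \<not> joined_off X {a, b} p w"
  proof (rule ccontr)
    assume "\<not> ?thesis"
    then have "joined_off X {a, b} x y" if "x \<in> topspace X - {a, b}" "y \<in> topspace X - {a, b}" for x y
      using that by (meson path_component_of_sym path_component_of_trans)
    then show False
      using not_path_connected_minus_two_points[OF abpq(1-3)] by (auto simp: path_connected_space_iff_path_component)
  qed
  then obtain w where w: "w \<in> topspace X - {a, b}" "\<not> joined_off X {a, b} p w"
    by blast
  have avoid: "x \<notin> {p, q}" if "joined_off X {a, b} w x" for x
    using that w(2) pq by (auto dest: path_component_of_sym path_component_of_trans)
  obtain h1 where h1: "pathin X h1" "h1 0 = w" "h1 1 = a"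
    "\<And>t. \<lbrakk>0 \<le> t; t < 1\<rbrakk> \<Longrightarrow> joined_off X {a, b} w (h1 t)"
    using path_to_one_puncture[of a b w] abpq w by auto
  obtain h2 where h2: "pathin X h2" "h2 0 = w" "h2 1 = b"
    "\<And>t. \<lbrakk>0 \<le> t; t < 1\<rbrakk> \<Longrightarrow> joined_off X {b, a} w (h2 t)"
    using path_to_one_puncture[of b a w] abpq w by auto
  have "h1 t \<notin> {p, q}" if "0 \<le> t" "t \<le> 1" for t
    using h1 avoid abpq(4) that by (cases "t = 1") auto
  then have 1: "joined_off X {p, q} w a"
    using joined_off_along_path[OF h1(1), of 0 1] h1 by auto
  have "h2 t \<notin> {p, q}" if "0 \<le> t" "t \<le> 1" for t
  proof (cases "t = 1")
    case False
    then show ?thesis using avoid h2(4)[of t] that by (simp add: insert_commute)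
  qed (use h2 abpq in auto)
  then have "joined_off X {p, q} w b"
    using joined_off_along_path[OF h2(1), of 0 1] h2 by auto
  with 1 show False
    using nsep by (meson path_component_of_sym path_component_of_trans)
qed

lemma arc_through_path_component:
  assumes pq: "p \<in> topspace X" "q \<in> topspace X" "p \<noteq> q" and w: "w \<in> topspace X - {p, q}"
  obtains \<alpha> where "pathin X \<alpha>" "inj_on \<alpha> {0..1}" "\<alpha> 0 = p" "\<alpha> 1 = q"
    "\<And>t. \<lbrakk>0 < t; t < 1\<rbrakk> \<Longrightarrow> joined_off X {p, q} w (\<alpha> t)"
proof -
  let ?W = "{p, q} \<union> {x. joined_off X {p, q} w x}"
  let ?Y = "subtopology X ?W"
  obtain h1 where h1: "pathin X h1" "h1 0 = w" "h1 1 = p"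
    "\<And>t. \<lbrakk>0 \<le> t; t < 1\<rbrakk> \<Longrightarrow> joined_off X {p, q} w (h1 t)"
    using path_to_one_puncture[of p q w] pq w by auto
  obtain h2 where h2: "pathin X h2" "h2 0 = w" "h2 1 = q"
    "\<And>t. \<lbrakk>0 \<le> t; t < 1\<rbrakk> \<Longrightarrow> joined_off X {q, p} w (h2 t)"
    using path_to_one_puncture[of q p w] pq w by auto
  have "h1 t \<in> ?W" if "t \<in> {0..1}" for t
    using h1 that by (cases "t = 1") auto
  then have "pathin ?Y h1"
    using h1(1) by (auto simp: pathin_subtopology)
  then have 1: "path_component_of ?Y w p"
    using h1 unfolding path_component_of_def by blast
  have "h2 t \<in> ?W" if "t \<in> {0..1}" for t
    using h2(3) h2(4)[of t] that by (cases "t = 1") (auto simp: insert_commute)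
  then have "pathin ?Y h2"
    using h2(1) by (auto simp: pathin_subtopology)
  then have "path_component_of ?Y w q"
    using h2 unfolding path_component_of_def by blast
  with path_component_of_sym[OF 1] have "path_component_of ?Y p q"
    by (rule path_component_of_trans)
  then obtain g where g: "pathin ?Y g" "g 0 = p" "g 1 = q"
    unfolding path_component_of_def by (elim exE conjE)
  have "Hausdorff_space ?Y" using Hausdorff by (rule Hausdorff_space_subtopology)
  then obtain \<alpha> where \<alpha>: "pathin ?Y \<alpha>" "inj_on \<alpha> {0..1}" "\<alpha> 0 = p" "\<alpha> 1 = q"
    by (rule Hausdorff_path_contains_arc[of ?Y g]) (use g pq(3) in auto)
  have "joined_off X {p, q} w (\<alpha> t)" if "0 < t" "t < 1" for t
  proof -
    have "\<alpha> t \<noteq> \<alpha> 0" "\<alpha> t \<noteq> \<alpha> 1"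
      using inj_onD[OF \<alpha>(2), of t 0] inj_onD[OF \<alpha>(2), of t 1] that by auto
    moreover have "\<alpha> t \<in> ?W"
      using \<alpha>(1) that by (auto simp: pathin_subtopology)
    ultimately show ?thesis using \<alpha> by auto
  qed
  then show ?thesis
    using that \<alpha> by (auto simp: pathin_subtopology)
qed

lemma exists_separated_arcs:
  assumes pq: "p \<in> topspace X" "q \<in> topspace X" "p \<noteq> q"
  obtains \<alpha> \<beta> where "separated_arcs X \<alpha> \<beta>"
proof -
  obtain u v where uv: "u \<in> topspace X - {p, q}" "v \<in> topspace X - {p, q}" "\<not> joined_off X {p, q} u v"
    using not_path_connected_minus_two_points[OF pq] by (auto simp: path_connected_space_iff_path_component)
  obtain \<alpha> where \<alpha>: "pathin X \<alpha>" "inj_on \<alpha> {0..1}" "\<alpha> 0 = p" "\<alpha> 1 = q"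
    "\<And>t. \<lbrakk>0 < t; t < 1\<rbrakk> \<Longrightarrow> joined_off X {p, q} u (\<alpha> t)"
    using arc_through_path_component[OF pq uv(1)] by blast
  obtain \<beta> where \<beta>: "pathin X \<beta>" "inj_on \<beta> {0..1}" "\<beta> 0 = p" "\<beta> 1 = q"
    "\<And>t. \<lbrakk>0 < t; t < 1\<rbrakk> \<Longrightarrow> joined_off X {p, q} v (\<beta> t)"
    using arc_through_path_component[OF pq uv(2)] by blast
  have "\<not> joined_off X {p, q} (\<alpha> s) (\<beta> t)" if "0 < s" "s < 1" "0 < t" "t < 1" for s t
    using uv(3) \<alpha>(5)[of s] \<beta>(5)[of t] that by (meson path_component_of_sym path_component_of_trans)
  then show ?thesis
    using that[of \<alpha> \<beta>] \<alpha> \<beta> by (simp add: separated_arcs_def)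
qed

text \<open>Two points on one of the arcs are separated by a point \<open>a\<close> between them and an interior point \<open>b\<close> of
  the other arc: \<open>{a, b}\<close> separates the end points of the arcs by symmetry, and each of the two given
  points is joined to one of these end points along its own arc.\<close>

lemma separate_same_arc:
  assumes S: "separated_arcs X \<alpha> \<beta>" and st: "0 \<le> s" "s < t" "t \<le> 1"
  shows "\<exists>a b. a \<in> \<alpha> ` {0..1} \<and> b \<in> \<beta> ` {0..1} \<and> {a, b} \<inter> {\<alpha> s, \<alpha> t} = {} \<and>
           \<not> joined_off X {a, b} (\<alpha> s) (\<alpha> t)"
proof -
  have A: "inj_on \<alpha> {0..1}" "inj_on \<beta> {0..1}" "\<alpha> 0 = \<beta> 0" "\<alpha> 1 = \<beta> 1" "pathin X \<alpha>" "pathin X \<beta>"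
    and B: "\<And>s t. \<lbrakk>0 < s; s < 1; 0 < t; t < 1\<rbrakk> \<Longrightarrow> \<not> joined_off X {\<alpha> 0, \<alpha> 1} (\<alpha> s) (\<beta> t)"
    using S unfolding separated_arcs_def by auto
  define m where "m = (s + t) / 2"
  have m: "s < m" "m < t" "0 < m" "m < 1" using st by (auto simp: m_def)
  have \<beta>ne: "\<beta> (1/2) \<noteq> \<alpha> r" if "0 \<le> r" "r \<le> 1" for r
    using separated_arcs_meet[OF S, of r "1/2"] that by auto
  have \<alpha>ne: "\<alpha> m \<noteq> \<alpha> r" if "0 \<le> r" "r \<le> 1" "r \<noteq> m" for r
    using arc_eqD[OF A(1), of m r] that m by auto
  have top: "\<alpha> m \<in> topspace X" "\<beta> (1/2) \<in> topspace X"
    using path_image_subset_topspace[OF A(5)] path_image_subset_topspace[OF A(6)] m by auto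
  have "\<not> joined_off X {\<alpha> m, \<beta> (1/2)} (\<alpha> 0) (\<alpha> 1)"
  proof (rule separation_symmetric)
    show "\<not> joined_off X {\<alpha> 0, \<alpha> 1} (\<alpha> m) (\<beta> (1/2))"
      using B m by simp
    show "{\<alpha> m, \<beta> (1/2)} \<inter> {\<alpha> 0, \<alpha> 1} = {}"
      using \<beta>ne[of 0] \<beta>ne[of 1] \<alpha>ne[of 0] \<alpha>ne[of 1] m by auto
  qed (use top \<beta>ne[of m] m in auto)
  moreover have "joined_off X {\<alpha> m, \<beta> (1/2)} (\<alpha> 0) (\<alpha> s)"
  proof (rule joined_off_along_path[OF A(5)])
    show "\<alpha> r \<notin> {\<alpha> m, \<beta> (1/2)}" if "0 \<le> r" "r \<le> s" for r
      using that st m \<beta>ne[of r] \<alpha>ne[of r] by auto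
  qed (use st in auto)
  moreover have "joined_off X {\<alpha> m, \<beta> (1/2)} (\<alpha> t) (\<alpha> 1)"
  proof (rule joined_off_along_path[OF A(5)])
    show "\<alpha> r \<notin> {\<alpha> m, \<beta> (1/2)}" if "t \<le> r" "r \<le> 1" for r
      using that st m \<beta>ne[of r] \<alpha>ne[of r] by auto
  qed (use st in auto)
  ultimately have "\<not> joined_off X {\<alpha> m, \<beta> (1/2)} (\<alpha> s) (\<alpha> t)"
    by (meson path_component_of_trans)
  moreover have "{\<alpha> m, \<beta> (1/2)} \<inter> {\<alpha> s, \<alpha> t} = {}"
    using \<beta>ne[of s] \<beta>ne[of t] \<alpha>ne[of s] \<alpha>ne[of t] m st by auto
  moreover have "\<alpha> m \<in> \<alpha> ` {0..1}" "\<beta> (1/2) \<in> \<beta> ` {0..1}"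
    using m by auto
  ultimately show ?thesis by blast
qed

text \<open>Two interior points on different arcs are separated by the common end points; all other pairs lie on
  one arc.\<close>

lemma circle_points_separated:
  assumes S: "separated_arcs X \<alpha> \<beta>" 
    and cd: "c \<in> \<alpha> ` {0..1} \<union> \<beta> ` {0..1}" "d \<in> \<alpha> ` {0..1} \<union> \<beta> ` {0..1}" "c \<noteq> d"
  obtains a b where "{a, b} \<subseteq> \<alpha> ` {0..1} \<union> \<beta> ` {0..1}" "{a, b} \<inter> {c, d} = {}" "\<not> joined_off X {a, b} c d"
proof -
  let ?C = "\<alpha> ` {0..1} \<union> \<beta> ` {0..1}"
  define sep where "sep c d \<longleftrightarrow> (\<exists>a b. {a, b} \<subseteq> ?C \<and> {a, b} \<inter> {c, d} = {} \<and> \<not> joined_off X {a, b} c d)"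
    for c d
  have sym: "sep d c" if "sep c d" for c d
  proof -
    obtain a b where "{a, b} \<subseteq> ?C" "{a, b} \<inter> {c, d} = {}" "\<not> joined_off X {a, b} c d"
      using \<open>sep c d\<close> unfolding sep_def by blast
    moreover from this have "{a, b} \<inter> {d, c} = {}" "\<not> joined_off X {a, b} d c"
      by (auto dest: path_component_of_sym)
    ultimately show ?thesis unfolding sep_def by blast
  qed
  have one_arc: "sep x y"
    if S': "separated_arcs X \<gamma> \<delta>" and C: "\<gamma> ` {0..1} \<union> \<delta> ` {0..1} = ?C"
      and xy: "x \<in> \<gamma> ` {0..1}" "y \<in> \<gamma> ` {0..1}" "x \<noteq> y" for \<gamma> \<delta> x y
  proof -
    have lt: "sep (\<gamma> s) (\<gamma> t)" if st: "0 \<le> s" "s < t" "t \<le> 1" for s t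
    proof -
      obtain a b where ab: "a \<in> \<gamma> ` {0..1}" "b \<in> \<delta> ` {0..1}" "{a, b} \<inter> {\<gamma> s, \<gamma> t} = {}"
        "\<not> joined_off X {a, b} (\<gamma> s) (\<gamma> t)"
        using separate_same_arc[OF S' st] by (elim exE conjE)
      then have "{a, b} \<subseteq> ?C"
        unfolding C[symmetric] by simp
      with ab show ?thesis unfolding sep_def by (intro exI conjI)
    qed
    obtain s t where st: "x = \<gamma> s" "s \<in> {0..1}" "y = \<gamma> t" "t \<in> {0..1}"
      using xy by blast
    then have "s < t \<or> t < s" using xy(3) by (cases s t rule: linorder_cases) auto
    then show ?thesis using lt[of s t] lt[of t s] st sym by auto
  qed
  have \<alpha>\<alpha>: "sep x y" if "x \<in> \<alpha> ` {0..1}" "y \<in> \<alpha> ` {0..1}" "x \<noteq> y" for x y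
    using one_arc[OF S refl that] .
  have \<beta>\<beta>: "sep x y" if "x \<in> \<beta> ` {0..1}" "y \<in> \<beta> ` {0..1}" "x \<noteq> y" for x y
    using one_arc[OF separated_arcs_sym[OF S] Un_commute that] .
  have ends: "\<alpha> 0 = \<beta> 0" "\<alpha> 1 = \<beta> 1" and inj: "inj_on \<alpha> {0..1}" "inj_on \<beta> {0..1}"
    and B: "\<And>s t. \<lbrakk>0 < s; s < 1; 0 < t; t < 1\<rbrakk> \<Longrightarrow> \<not> joined_off X {\<alpha> 0, \<alpha> 1} (\<alpha> s) (\<beta> t)"
    using S unfolding separated_arcs_def by auto
  have \<alpha>\<beta>: "sep x y" if xy: "x \<in> \<alpha> ` {0..1}" "y \<in> \<beta> ` {0..1}" "x \<noteq> y" for x y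
  proof -
    obtain s t where st: "x = \<alpha> s" "s \<in> {0..1}" "y = \<beta> t" "t \<in> {0..1}"
      using xy by blast
    then consider "s \<in> {0, 1}" | "t \<in> {0, 1}" | "0 < s" "s < 1" "0 < t" "t < 1"
      by force
    then show ?thesis
    proof cases
      case 1
      then have "x \<in> \<beta> ` {0..1}" using ends st by auto
      then show ?thesis using \<beta>\<beta> xy by blast
    next
      case 2
      then have "y \<in> \<alpha> ` {0..1}" using ends[symmetric] st by auto
      then show ?thesis using \<alpha>\<alpha> xy by blast
    next
      case 3
      have "\<alpha> s \<noteq> \<alpha> 0" "\<alpha> s \<noteq> \<alpha> 1" "\<beta> t \<noteq> \<alpha> 0" "\<beta> t \<noteq> \<alpha> 1"
        using arc_eqD[OF inj(1), of s 0] arc_eqD[OF inj(1), of s 1] arc_eqD[OF inj(2), of t 0]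
          arc_eqD[OF inj(2), of t 1] 3 ends by auto
      then have "{\<alpha> 0, \<alpha> 1} \<inter> {x, y} = {}"
        using st by auto
      moreover have "\<not> joined_off X {\<alpha> 0, \<alpha> 1} x y" using B[OF 3] st by simp
      moreover have "{\<alpha> 0, \<alpha> 1} \<subseteq> \<alpha> ` {0..1} \<union> \<beta> ` {0..1}" by auto
      ultimately show ?thesis unfolding sep_def by blast
    qed
  qed
  have "sep c d"
    using cd(1,2)
  proof (elim UnE)
    assume "c \<in> \<beta> ` {0..1}" "d \<in> \<alpha> ` {0..1}"
    then show ?thesis using cd(3)[symmetric] by (intro sym[OF \<alpha>\<beta>])
  qed (use \<alpha>\<alpha> \<beta>\<beta> \<alpha>\<beta> cd(3) in simp_all)
  then show ?thesis unfolding sep_def by (elim exE conjE) (rule that)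
qed

lemma separated_arcs_cover:
  assumes S: "separated_arcs X \<alpha> \<beta>" 
  shows "topspace X = \<alpha> ` {0..1} \<union> \<beta> ` {0..1}"
proof
  let ?C = "\<alpha> ` {0..1} \<union> \<beta> ` {0..1}"
  have pth: "pathin X \<alpha>" "pathin X \<beta>" and inj: "inj_on \<alpha> {0..1}"
    using S unfolding separated_arcs_def by auto
  show C: "?C \<subseteq> topspace X"
    using path_image_subset_topspace[OF pth(1)] path_image_subset_topspace[OF pth(2)] by auto
  have clC: "closedin X ?C"
    using Hausdorff pth by (intro closedin_Un compactin_imp_closedin compactin_path_image)
  have ends: "\<alpha> 0 \<in> ?C" "\<alpha> 1 \<in> ?C" "\<alpha> 0 \<noteq> \<alpha> 1"
    using arc_eqD[OF inj, of 0 1] by auto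
  show "topspace X \<subseteq> ?C"
  proof (rule ccontr)
    assume "\<not> ?thesis"
    then obtain z where z: "z \<in> topspace X" "z \<notin> ?C" by blast
    \<comment> \<open>From \<open>z\<close> the curve can be reached for the first time at a point different from any given \<open>c\<close>.\<close>
    have land: "\<exists>h. pathin X h \<and> h 0 = z \<and> h 1 \<in> ?C \<and> h 1 \<noteq> c \<and> (\<forall>t. 0 \<le> t \<and> t < 1 \<longrightarrow> h t \<notin> ?C)"
      if "c \<in> topspace X" "c \<noteq> z" for c
    proof -
      obtain e where e: "e \<in> ?C" "e \<noteq> c" using ends by metis
      have "joined_off X {c} z e"
        using z that e C by (intro path_connected_space_imp_path_component_of path_connected_minus_point) auto
      then obtain g where g: "pathin X g" "g 0 = z" "g 1 = e" "\<And>t. \<lbrakk>0 \<le> t; t \<le> 1\<rbrakk> \<Longrightarrow> g t \<notin> {c}"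
        by (rule joined_offE) blast
      obtain h where "pathin X h" "h 0 = g 0" "h 1 \<in> ?C" "\<And>t. \<lbrakk>0 \<le> t; t < 1\<rbrakk> \<Longrightarrow> h t \<notin> ?C"
        "h ` {0..1} \<subseteq> g ` {0..1}"
        by (rule path_first_hit[OF g(1) clC]) (use g z e in auto)
      moreover have "h 1 \<noteq> c"
      proof -
        have "h 1 \<in> g ` {0..1}" using \<open>h ` {0..1} \<subseteq> g ` {0..1}\<close> by auto
        then show ?thesis using g(4) by (metis atLeastAtMost_iff imageE singletonI)
      qed
      ultimately show ?thesis using g(2) by (intro exI[of _ h]) auto
    qed
    have "\<alpha> 0 \<in> topspace X" "\<alpha> 0 \<noteq> z"
      using ends(1) C z(2) by auto
    from land[OF this] obtain h1 where h1: "pathin X h1" "h1 0 = z" "h1 1 \<in> ?C"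
      "\<forall>t. 0 \<le> t \<and> t < 1 \<longrightarrow> h1 t \<notin> ?C"
      by (elim exE conjE)
    have "h1 1 \<in> topspace X" "h1 1 \<noteq> z"
      using h1(3) C z(2) by auto
    from land[OF this] obtain h2 where h2: "pathin X h2" "h2 0 = z" "h2 1 \<in> ?C" "h2 1 \<noteq> h1 1"
      "\<forall>t. 0 \<le> t \<and> t < 1 \<longrightarrow> h2 t \<notin> ?C"
      by (elim exE conjE)
    obtain a b where ab: "{a, b} \<subseteq> ?C" "{a, b} \<inter> {h1 1, h2 1} = {}" "\<not> joined_off X {a, b} (h1 1) (h2 1)"
      by (rule circle_points_separated[OF S h1(3) h2(3) h2(4)[symmetric]])
    have "h1 t \<notin> {a, b}" if "0 \<le> t" "t \<le> 1" for t
      using h1(4)[rule_format, of t] ab that by (cases "t = 1") auto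
    then have "joined_off X {a, b} z (h1 1)"
      using joined_off_along_path[OF h1(1), of 0 1] h1(2) by auto
    moreover have "h2 t \<notin> {a, b}" if "0 \<le> t" "t \<le> 1" for t
      using h2(5)[rule_format, of t] ab that by (cases "t = 1") auto
    then have "joined_off X {a, b} z (h2 1)"
      using joined_off_along_path[OF h2(1), of 0 1] h2(2) by auto
    ultimately show False
      using ab(3) by (meson path_component_of_sym path_component_of_trans)
  qed
qed

end

section \<open>The circle as a quotient of an interval\<close>

lemma cong_Z_class_eq_iff: "cong_Z `` {x} = cong_Z `` {y} \<longleftrightarrow> x - y \<in> \<int>"
  using eq_equiv_class_iff[OF equiv_cong_Z, of x y] by (simp add: cong_Z_def)

text \<open>The exponential parametrization of the unit circle induces a continuous injection into the complex
  plane.\<close>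

lemma Hausdorff_circle_R_mod_Z: "Hausdorff_space circle_R_mod_Z"
proof -
  have cis_eq: "cis (2 * pi * x) = cis (2 * pi * y) \<longleftrightarrow> x - y \<in> \<int>" for x y
  proof -
    have "cis (2 * pi * x) = cis (2 * pi * y)
        \<longleftrightarrow> sin (2 * pi * x) = sin (2 * pi * y) \<and> cos (2 * pi * x) = cos (2 * pi * y)"
      by (auto simp: complex_eq_iff)
    also have "\<dots> \<longleftrightarrow> (\<exists>n::int. 2 * pi * x = 2 * pi * y + 2 * pi * n)"
      by (rule sin_cos_eq_iff)
    also have "\<dots> \<longleftrightarrow> (\<exists>n::int. x = y + n)"
      by (simp flip: distrib_left)
    also have "\<dots> \<longleftrightarrow> (\<exists>n::int. x - y = of_int n)"
      by (simp add: algebra_simps)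
    also have "\<dots> \<longleftrightarrow> x - y \<in> \<int>"
      by (auto simp: Ints_def)
    finally show ?thesis .
  qed
  have cont: "continuous_map euclideanreal euclidean (\<lambda>x. cis (2 * pi * x))"
    by (auto intro!: continuous_intros)
  obtain f where f: "continuous_map circle_R_mod_Z euclidean f"
    "\<And>x. x \<in> topspace euclideanreal \<Longrightarrow> f (cong_Z `` {x}) = cis (2 * pi * x)"
    by (rule quotient_map_lift_exists[OF quotient_map_circle_R_mod_Z cont])
       (auto simp: cis_eq cong_Z_class_eq_iff)
  have "inj_on f (topspace circle_R_mod_Z)"
    by (auto simp: inj_on_def topspace_circle_R_mod_Z quotient_def f(2) cis_eq cong_Z_class_eq_iff)
  then show ?thesis
    using f(1) by (intro Hausdorff_space_injective_preimage[of euclidean _ f]) auto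
qed

text \<open>The closed path is a quotient map, being a continuous surjection from a compact space onto a Hausdorff
  space.  Its fibres are those of the projection modulo the integers restricted to \<open>{0..1}\<close>.\<close>

lemma simple_closed_path_homeomorphic_circle:
  assumes "Hausdorff_space X" "pathin X \<gamma>" "\<gamma> ` {0..1} = topspace X" "\<gamma> 0 = \<gamma> 1" "inj_on \<gamma> {0..<1}"
  shows "X homeomorphic_space circle_R_mod_Z"
proof -
  let ?I = "top_of_set {0..1::real}"
  let ?\<pi> = "\<lambda>x. cong_Z `` {x}"
  have qm: "quotient_map ?I X \<gamma>"
    using assms by (intro continuous_imp_quotient_map) (auto simp: pathin_def compact_space_subtopology)
  have cont: "continuous_map ?I circle_R_mod_Z ?\<pi>"
    using quotient_imp_continuous_map[OF quotient_map_circle_R_mod_Z]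
    by (rule continuous_map_from_subtopology)
  have fibres: "\<gamma> s = \<gamma> t \<longleftrightarrow> ?\<pi> s = ?\<pi> t" if "s \<in> {0..1}" "t \<in> {0..1}" for s t
  proof -
    have eq: "\<gamma> s = \<gamma> t \<longleftrightarrow> s = t \<or> {s, t} = {0, 1}"
    proof
      assume "\<gamma> s = \<gamma> t"
      show "s = t \<or> {s, t} = {0, 1}"
      proof (cases "s = 1 \<or> t = 1")
        case False
        then show ?thesis using \<open>\<gamma> s = \<gamma> t\<close> inj_onD[OF assms(5), of s t] that by auto
      next
        case True
        then have "s = 1 \<and> t = 1 \<or> s = 1 \<and> t < 1 \<or> t = 1 \<and> s < 1"
          using that by (auto simp: order_le_less)
        then consider "s = 1" "t = 1" | "s = 1" "t < 1" | "t = 1" "s < 1"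
          by blast
        then show ?thesis
          using \<open>\<gamma> s = \<gamma> t\<close> inj_onD[OF assms(5), of 0 t] inj_onD[OF assms(5), of 0 s] assms(4) that
          by cases auto
      qed
    qed (auto simp: assms(4) doubleton_eq_iff)
    also have "\<dots> \<longleftrightarrow> s - t \<in> \<int>"
    proof
      assume "s - t \<in> \<int>"
      then obtain n :: int where n: "s - t = n" by (auto elim: Ints_cases)
      have "-1 \<le> s - t" "s - t \<le> 1" using that by auto
      then have "-1 \<le> n" "n \<le> 1" unfolding n by linarith+
      then have "n = -1 \<or> n = 0 \<or> n = 1" by auto
      then show "s = t \<or> {s, t} = {0, 1}"
        using n that by (auto simp: doubleton_eq_iff)
    qed (auto simp: doubleton_eq_iff)
    finally show ?thesis by (simp add: cong_Z_class_eq_iff)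
  qed
  obtain k where k: "continuous_map X circle_R_mod_Z k" "k ` topspace X = ?\<pi> ` topspace ?I"
    "\<And>x. x \<in> topspace ?I \<Longrightarrow> k (\<gamma> x) = ?\<pi> x"
    by (rule quotient_map_lift_exists[OF qm cont]) (use fibres in auto)
  have "?\<pi> ` {0..1} = topspace circle_R_mod_Z"
  proof
    show "topspace circle_R_mod_Z \<subseteq> ?\<pi> ` {0..1}"
    proof
      fix A assume "A \<in> topspace circle_R_mod_Z"
      then obtain x where "A = ?\<pi> x"
        by (auto simp: topspace_circle_R_mod_Z quotient_def)
      also have "?\<pi> x = ?\<pi> (frac x)"
        by (simp add: cong_Z_class_eq_iff frac_def)
      finally show "A \<in> ?\<pi> ` {0..1}"
        using frac_lt_1[of x] by (auto intro!: image_eqI[of _ _ "frac x"])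
    qed
  qed (auto simp: topspace_circle_R_mod_Z quotient_def)
  moreover have "inj_on k (topspace X)"
    unfolding assms(3)[symmetric] using k(3) fibres by (auto simp: inj_on_def)
  moreover have "compact_space X"
    using compactin_path_image[OF assms(2)] assms(3) by (simp add: compact_space_def)
  ultimately have "homeomorphic_map X circle_R_mod_Z k"
    using k Hausdorff_circle_R_mod_Z by (intro continuous_imp_homeomorphic_map) auto
  then show ?thesis
    by (rule homeomorphic_map_imp_homeomorphic_space)
qed

lemma separated_arcs_homeomorphic_circle:
  assumes "Hausdorff_space X" and S: "separated_arcs X \<alpha> \<beta>"
    and cover: "topspace X = \<alpha> ` {0..1} \<union> \<beta> ` {0..1}"
  shows "X homeomorphic_space circle_R_mod_Z"
proof -
  have A: "pathin X \<alpha>" "pathin X \<beta>" "inj_on \<alpha> {0..1}" "inj_on \<beta> {0..1}" "\<alpha> 0 = \<beta> 0" "\<alpha> 1 = \<beta> 1"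
    using S unfolding separated_arcs_def by auto
  let ?I = "top_of_set {0..1::real}"
  \<comment> \<open>Run along \<open>\<alpha>\<close> and return along \<open>\<beta>\<close>.\<close>
  define \<gamma> where "\<gamma> t = (if t \<le> 1/2 then \<alpha> (2 * t) else \<beta> (2 - 2 * t))" for t :: real
  have "continuous_map ?I X (\<lambda>t. if t \<le> 1/2 then (\<alpha> \<circ> (\<lambda>t. 2 * t)) t else (\<beta> \<circ> (\<lambda>t. 2 - 2 * t)) t)"
  proof (intro continuous_map_cases_le continuous_map_compose)
    show "continuous_map (subtopology ?I {x \<in> topspace ?I. x \<le> 1/2}) ?I (\<lambda>t. 2 * t)"
      by (auto simp: subtopology_subtopology continuous_map_in_subtopology intro!: continuous_intros)
    show "continuous_map (subtopology ?I {x \<in> topspace ?I. 1/2 \<le> x}) ?I (\<lambda>t. 2 - 2 * t)"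
      by (auto simp: subtopology_subtopology continuous_map_in_subtopology intro!: continuous_intros)
    show "(\<alpha> \<circ> (\<lambda>t. 2 * t)) t = (\<beta> \<circ> (\<lambda>t. 2 - 2 * t)) t" if "t = 1/2" for t
    proof -
      have *: "2 * t = 1" "2 - 2 * t = 1" using that by auto
      show ?thesis unfolding o_def unfolding *(2) unfolding *(1) by (rule A(6))
    qed
  qed (use A(1,2) in \<open>auto simp: pathin_def\<close>)
  then have "pathin X \<gamma>"
    unfolding pathin_def \<gamma>_def[abs_def] o_def .
  moreover have "\<gamma> ` {0..1} = topspace X"
  proof
    show "\<gamma> ` {0..1} \<subseteq> topspace X"
      unfolding cover by (auto simp: \<gamma>_def)
    have "\<alpha> t = \<gamma> (t/2)" "\<beta> t = \<gamma> (1 - t/2)" if "t \<in> {0..1}" for t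
      using that A(6) by (auto simp: \<gamma>_def)
    then show "topspace X \<subseteq> \<gamma> ` {0..1}"
      unfolding cover by (auto intro!: image_eqI)
  qed
  moreover have "\<gamma> 0 = \<gamma> 1"
    using A(5) by (simp add: \<gamma>_def)
  moreover have "inj_on \<gamma> {0..<1}"
  proof -
    have mix: False if "0 \<le> s" "s \<le> 1/2" "1/2 < t" "t < 1" "\<alpha> (2 * s) = \<beta> (2 - 2 * t)" for s t :: real
      using separated_arcs_meet[OF S, of "2 * s" "2 - 2 * t"] that by auto
    show ?thesis
    proof (rule inj_onI)
      fix s t :: real assume st: "s \<in> {0..<1}" "t \<in> {0..<1}" "\<gamma> s = \<gamma> t"
      show "s = t"
        using st mix[of s t] mix[of t s] arc_eqD[OF A(3), of "2 * s" "2 * t"]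
          arc_eqD[OF A(4), of "2 - 2 * s" "2 - 2 * t"]
        by (auto simp: \<gamma>_def split: if_splits)
    qed
  qed
  ultimately show ?thesis
    by (rule simple_closed_path_homeomorphic_circle[OF assms(1)])
qed

theorem theorem1p8:
  fixes X :: "'a topology"
  assumes "Hausdorff_space X"
    and "two_path_flimsy X"
  shows "X homeomorphic_space circle_R_mod_Z"
proof -
  interpret Hausdorff_two_path_flimsy X
    using assms by unfold_locales
  obtain p q where pq: "p \<in> topspace X" "q \<in> topspace X" "p \<noteq> q"
    by (rule two_points)
  obtain \<alpha> \<beta> where S: "separated_arcs X \<alpha> \<beta>"
    by (rule exists_separated_arcs[OF pq])
  show ?thesis
    using Hausdorff S separated_arcs_cover[OF S] by (rule separated_arcs_homeomorphic_circle)
qed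

end
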